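(* Consider the hierarchical model described in the context, with finite parameter sets $\mathcal{W}_1,\dots,\mathcal{W}_d$, levels bounded by $\rho_1,\dots,\rho_d$, and the realizability assumption with true parameters $\hat{\mathsf{w}}=(\hat w_1,\dots,\hat w_d)$. Let $\lambda_1>\lambda_2>\dots>\lambda_d>\lambda_{d+1}:=0$, let $\mu$ be a probability distribution on $\mathcal{X}$, let $\mathsf{S}\sim P_{\mathsf{S}}=\mu^{\otimes n}$, and let $(\mathsf{S},\mathsf{W})\sim P_{\mathsf{S}}P^{*}_{\mathsf{W}|\mathsf{S}}$, where $P^{*}_{\mathsf{W}|\mathsf{S}}=P^{*}_{W_1|\mathsf{S}}P^{*}_{W_2|W_1\mathsf{S}}\cdots P^{*}_{W_d|W_1^{d-1}\mathsf{S}}$ with $$P^{*}_{W_k|W_1^{k-1}\mathsf{S}}(w_k|w_1^{k-1}\mathsf{s})=\frac{\exp\left(-\ell_k(w_1^k,\mathsf{s})/\lambda_k\right)}{\sum_{w_k'\in\mathcal{W}_k}\exp\left(-\ell_k(w_1^{k-1}w_k',\mathsf{s})/\lambda_k\right)},\qquad 1\le k\le d.$$ Then the average chained risk of the training mechanism $P^{*}_{\mathsf{W}|\mathsf{S}}$ satisfies $$\mathbb{E}\left[L_\mu^{\mathfrak{C}}(\mathsf{W})\right]\le\sum_{k=1}^d\left(2(\lambda_k-\lambda_{k+1})\left(\sum_{m=1}^k\log|\mathcal{W}_m|\right)+\frac{\rho_k^2}{2n(\lambda_k-\lambda_{k+1})}\right).$$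
   Context: Notation: $\mathsf{w}=(w_1,\dots,w_d)$, $w_1^k=(w_1,\dots,w_k)$, $w_1^{k-1}w_k'=(w_1,\dots,w_{k-1},w_k')$. Model. Let $d\ge1$ be an integer, $\varepsilon>0$, $\beta>1$, $R:=\varepsilon\beta^d$, $\gamma_k:=\beta^{k-d}$ for $0\le k\le d$, $\mathcal{X}:=\{x\in\mathbb{R}:\varepsilon\le|x|<R\}$, and $\mathcal{X}_k:=\{x\in\mathbb{R}:R\gamma_{k-1}\le|x|<R\gamma_k\}$ for $1\le k\le d$. The target function $f:(-R,R)\to\mathbb{R}$ satisfies $f(0)=0$ and is an $(M_1,M_2)$-diffeomorphism: it is invertible, and $f$ and $f^{-1}$ are twice differentiable, $M_1$-Lipschitz, and have $M_2$-Lipschitz derivatives. For each $k$ and each $w_k\in\mathcal{W}_k$ a real function $\mathcal{F}(\cdot,w_k)$ with $|\mathcal{F}(\cdot,w_k)|\le\rho_k$ is given. Set $h_0(x):=f(\gamma_0x)/\gamma_0$ and $h_k(x):=h_{k-1}(x)+\mathcal{F}(h_{k-1}(x),w_k)$ for $1\le k\le d$, so $h_k$ depends on $w_1^k$. Losses. For $1\le k\le d$, $\ell_k(w_1^k,x):=\left|\gamma_kh_k(x/\gamma_k)-f(x)\right|$ if $x\in\mathcal{X}_k$ and $\ell_k(w_1^k,x):=0$ if $x\notin\mathcal{X}_k$; $\ell_k(w_1^k,\mathsf{s}):=\frac1n\sum_{i=1}^n\ell_k(w_1^k,x_i)$ for $\mathsf{s}=(x_1,\dots,x_n)$. Realizability.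 For $0<\gamma\le1$ put $f_{[\gamma]}(x):=f(\gamma x)/\gamma$, and let $\psi_k(x):=f_{[\gamma_k]}\circ f_{[\gamma_{k-1}]}^{-1}(x)-x$. It is assumed that there are $\hat w_k\in\mathcal{W}_k$, $1\le k\le d$, such that $\psi_k(\cdot)=\mathcal{F}(\cdot,\hat w_k)$. Chained risk. For fixed $\mathsf{w}$, $L_\mu^{\mathfrak{C}}(\mathsf{w}):=\mathbb{E}\left[\sum_{k=1}^d\left(\ell_k(w_1^k,\mathsf{S})-\ell_k(w_1^{k-1}\hat w_k,\mathsf{S})\right)\right]$ with $\mathsf{S}\sim\mu^{\otimes n}$; $\mathbb{E}[L_\mu^{\mathfrak{C}}(\mathsf{W})]$ is the expectation of this function evaluated at the random $\mathsf{W}$. *)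

theory Defs
  imports "HOL-Probability.Probability"
begin

text \<open>
  Conventions. Levels and samples are indexed from 1, as on paper. A parameter vector
  \<open>(w\<^sub>1, \<dots>, w\<^sub>d)\<close> is a function \<open>w :: nat \<Rightarrow> 'w\<close>, an element of \<open>PiE {1..d} W\<close>; the prefix
  \<open>w\<^sub>1\<^sup>k\<close> is not a separate object, since level-\<open>k\<close> quantities read only \<open>w 1, \<dots>, w k\<close>, and
  \<open>w\<^sub>1\<^sup>k\<^sup>-\<^sup>1 w\<^sub>k'\<close> is \<open>w(k := w')\<close>. The target \<open>f\<close> is a total function of which only the
  restriction to \<open>(-R, R)\<close> matters.
\<close>

definition radius :: "nat \<Rightarrow> real \<Rightarrow> real \<Rightarrow> real" where
  "radius d \<epsilon> \<beta> = \<epsilon> * \<beta> ^ d"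

definition scale :: "nat \<Rightarrow> real \<Rightarrow> nat \<Rightarrow> real" where
  "scale d \<beta> k = \<beta> powi (int k - int d)"

definition input_space :: "nat \<Rightarrow> real \<Rightarrow> real \<Rightarrow> real set" where
  "input_space d \<epsilon> \<beta> = {x. \<epsilon> \<le> \<bar>x\<bar> \<and> \<bar>x\<bar> < radius d \<epsilon> \<beta>}"

definition level_space :: "nat \<Rightarrow> real \<Rightarrow> real \<Rightarrow> nat \<Rightarrow> real set" where
  "level_space d \<epsilon> \<beta> k =
     {x. radius d \<epsilon> \<beta> * scale d \<beta> (k - 1) \<le> \<bar>x\<bar> \<and> \<bar>x\<bar> < radius d \<epsilon> \<beta> * scale d \<beta> k}"

definition smooth_bounds_on :: "real \<Rightarrow> real \<Rightarrow> real set \<Rightarrow> (real \<Rightarrow> real) \<Rightarrow> bool" where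
  "smooth_bounds_on M1 M2 S g \<longleftrightarrow>
     (\<forall>x\<in>S. g differentiable (at x)) \<and> (\<forall>x\<in>S. deriv g differentiable (at x)) \<and>
     M1-lipschitz_on S g \<and> M2-lipschitz_on S (deriv g)"

text \<open>
  The inverse lives on the image \<open>g ` S\<close>. For an open interval \<open>S\<close> and continuous injective \<open>g\<close>
  this image is open, so the derivatives of \<open>inv_into S g\<close> at its points do not depend on the
  arbitrary values of \<open>inv_into\<close> outside it.
\<close>

definition diffeomorphism_bounds_on :: "real \<Rightarrow> real \<Rightarrow> real set \<Rightarrow> (real \<Rightarrow> real) \<Rightarrow> bool" where
  "diffeomorphism_bounds_on M1 M2 S g \<longleftrightarrow>
     inj_on g S \<and> smooth_bounds_on M1 M2 S g \<and> smooth_bounds_on M1 M2 (g ` S) (inv_into S g)"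

definition dilation :: "(real \<Rightarrow> real) \<Rightarrow> real \<Rightarrow> real \<Rightarrow> real" where
  "dilation f \<gamma> x = f (\<gamma> * x) / \<gamma>"

text \<open>
  For \<open>0 < \<gamma> \<le> 1\<close> the dilation is regarded as a function on \<open>(-R, R)\<close>, the domain of \<open>f\<close>. Hence
  \<open>\<psi>\<^sub>k\<close> is defined on \<open>level_correction_dom\<close>, the image of \<open>(-R, R)\<close> under
  \<open>dilation f (scale d \<beta> (k - 1))\<close>, and only its values there are meaningful.
\<close>

definition level_correction_dom :: "nat \<Rightarrow> real \<Rightarrow> real \<Rightarrow> (real \<Rightarrow> real) \<Rightarrow> nat \<Rightarrow> real set" where
  "level_correction_dom d \<epsilon> \<beta> f k =
     dilation f (scale d \<beta> (k - 1)) ` {- radius d \<epsilon> \<beta><..<radius d \<epsilon> \<beta>}"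

definition level_correction :: "nat \<Rightarrow> real \<Rightarrow> real \<Rightarrow> (real \<Rightarrow> real) \<Rightarrow> nat \<Rightarrow> real \<Rightarrow> real" where
  "level_correction d \<epsilon> \<beta> f k x =
     dilation f (scale d \<beta> k)
       (inv_into {- radius d \<epsilon> \<beta><..<radius d \<epsilon> \<beta>} (dilation f (scale d \<beta> (k - 1))) x) - x"

text \<open>
  In \<open>F k x v\<close> the level \<open>k\<close> is an explicit argument, so that parameter sets of different levels
  may overlap without sharing the parametrized functions.
\<close>

primrec hierarchical_output ::
  "nat \<Rightarrow> real \<Rightarrow> (real \<Rightarrow> real) \<Rightarrow> (nat \<Rightarrow> real \<Rightarrow> 'w \<Rightarrow> real) \<Rightarrow> nat \<Rightarrow> (nat \<Rightarrow> 'w) \<Rightarrow> real \<Rightarrow> real"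
  where
  "hierarchical_output d \<beta> f F 0 w x = dilation f (scale d \<beta> 0) x"
| "hierarchical_output d \<beta> f F (Suc k) w x =
     hierarchical_output d \<beta> f F k w x + F (Suc k) (hierarchical_output d \<beta> f F k w x) (w (Suc k))"

definition level_loss ::
  "nat \<Rightarrow> real \<Rightarrow> real \<Rightarrow> (real \<Rightarrow> real) \<Rightarrow> (nat \<Rightarrow> real \<Rightarrow> 'w \<Rightarrow> real) \<Rightarrow> nat \<Rightarrow> (nat \<Rightarrow> 'w) \<Rightarrow> real \<Rightarrow> real"
  where
  "level_loss d \<epsilon> \<beta> f F k w x =
     (if x \<in> level_space d \<epsilon> \<beta> k
      then \<bar>scale d \<beta> k * hierarchical_output d \<beta> f F k w (x / scale d \<beta> k) - f x\<bar>
      else 0)"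

definition empirical_loss ::
  "nat \<Rightarrow> real \<Rightarrow> real \<Rightarrow> (real \<Rightarrow> real) \<Rightarrow> (nat \<Rightarrow> real \<Rightarrow> 'w \<Rightarrow> real) \<Rightarrow> nat \<Rightarrow>
     nat \<Rightarrow> (nat \<Rightarrow> 'w) \<Rightarrow> (nat \<Rightarrow> real) \<Rightarrow> real"
  where
  "empirical_loss d \<epsilon> \<beta> f F n k w s = (\<Sum>i=1..n. level_loss d \<epsilon> \<beta> f F k w (s i)) / real n"

definition sample_measure :: "nat \<Rightarrow> real measure \<Rightarrow> (nat \<Rightarrow> real) measure" where
  "sample_measure n \<mu> = (\<Pi>\<^sub>M i\<in>{1..n}. \<mu>)"

definition gibbs_conditional ::
  "nat \<Rightarrow> real \<Rightarrow> real \<Rightarrow> (real \<Rightarrow> real) \<Rightarrow> (nat \<Rightarrow> real \<Rightarrow> 'w \<Rightarrow> real) \<Rightarrow> nat \<Rightarrow> (nat \<Rightarrow> 'w set) \<Rightarrow>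
     (nat \<Rightarrow> real) \<Rightarrow> nat \<Rightarrow> (nat \<Rightarrow> 'w) \<Rightarrow> (nat \<Rightarrow> real) \<Rightarrow> real"
  where
  "gibbs_conditional d \<epsilon> \<beta> f F n W lam k w s =
     exp (- empirical_loss d \<epsilon> \<beta> f F n k w s / lam k) /
     (\<Sum>w'\<in>W k. exp (- empirical_loss d \<epsilon> \<beta> f F n k (w(k := w')) s / lam k))"

text \<open>
  The joint law of sample and parameters: the product of the conditional probability mass
  functions is the density with respect to the sample law times counting measure.
\<close>

definition training_measure ::
  "nat \<Rightarrow> real \<Rightarrow> real \<Rightarrow> (real \<Rightarrow> real) \<Rightarrow> (nat \<Rightarrow> real \<Rightarrow> 'w \<Rightarrow> real) \<Rightarrow> nat \<Rightarrow> (nat \<Rightarrow> 'w set) \<Rightarrow>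
     (nat \<Rightarrow> real) \<Rightarrow> real measure \<Rightarrow> ((nat \<Rightarrow> real) \<times> (nat \<Rightarrow> 'w)) measure"
  where
  "training_measure d \<epsilon> \<beta> f F n W lam \<mu> =
     density (sample_measure n \<mu> \<Otimes>\<^sub>M count_space (PiE {1..d} W))
       (\<lambda>(s, w). ennreal (\<Prod>k=1..d. gibbs_conditional d \<epsilon> \<beta> f F n W lam k w s))"

definition chained_risk ::
  "nat \<Rightarrow> real \<Rightarrow> real \<Rightarrow> (real \<Rightarrow> real) \<Rightarrow> (nat \<Rightarrow> real \<Rightarrow> 'w \<Rightarrow> real) \<Rightarrow> nat \<Rightarrow> (nat \<Rightarrow> 'w) \<Rightarrow>
     real measure \<Rightarrow> (nat \<Rightarrow> 'w) \<Rightarrow> real"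
  where
  "chained_risk d \<epsilon> \<beta> f F n w_true \<mu> w =
     (\<integral>s. (\<Sum>k=1..d. empirical_loss d \<epsilon> \<beta> f F n k w s
                      - empirical_loss d \<epsilon> \<beta> f F n k (w(k := w_true k)) s)
        \<partial>sample_measure n \<mu>)"

end

theory Submission
  imports Defs
begin

text \<open>
  The Gibbs formula gives, pointwise, that the empirical excess of the level-\<open>k\<close> loss over that of
  \<open>w_true k\<close> is at most \<open>- lam k\<close> times the logarithm of the level-\<open>k\<close> conditional
  probability. The generalization gap at level \<open>k\<close> is controlled with inverse temperature
  \<open>1 / (lam k - lam (k + 1))\<close>: the Gibbs variational principle against the uniform law on prefixes
  of length \<open>k\<close> costs the logarithm of the probability of the prefix plus the logarithm of the number
  of prefixes, and Hoeffding's lemma bounds the exponential moment. By summation by parts the two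
  families of log-probabilities cancel exactly. Hoeffding's lemma gives the constant \<open>\<rho> k\<close> because
  the levels of the input space are disjoint: the first \<open>k - 1\<close> parameters do not see where the points
  of level \<open>k\<close> lie, so a loss depending only on these parameters can be averaged over level \<open>k\<close>
  beforehand.
\<close>

section \<open>Sums and product measures\<close>

lemma sum_PiE_Suc:
  fixes h :: "(nat \<Rightarrow> 'a) \<Rightarrow> 'b::comm_monoid_add"
  shows "(\<Sum>w\<in>PiE {1..Suc k} W. h w) = (\<Sum>w\<in>PiE {1..k} W. \<Sum>v\<in>W (Suc k). h (w(Suc k := v)))"
proof -
  have eq: "{1..Suc k} = insert (Suc k) {1..k}" by auto
  have "(\<Sum>w\<in>PiE {1..Suc k} W. h w)
      = (\<Sum>p\<in>W (Suc k) \<times> PiE {1..k} W. h ((\<lambda>(v, w). w(Suc k := v)) p))"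
    unfolding eq PiE_insert_eq by (subst sum.reindex) (auto intro!: inj_combinator)
  also have "\<dots> = (\<Sum>v\<in>W (Suc k). \<Sum>w\<in>PiE {1..k} W. h (w(Suc k := v)))"
    by (simp add: sum.cartesian_product case_prod_unfold)
  also have "\<dots> = (\<Sum>w\<in>PiE {1..k} W. \<Sum>v\<in>W (Suc k). h (w(Suc k := v)))"
    by (rule sum.swap)
  finally show ?thesis .
qed

text \<open>Abel summation. With \<open>a = lam\<close>, whose entry at \<open>d + 1\<close> is 0,
  it turns the weights \<open>lam k\<close> of single conditionals into the weights
  \<open>gap k\<close> of whole prefixes.\<close>

lemma sum_diff_times_partial_sums:
  fixes a x :: "nat \<Rightarrow> real"
  shows "(\<Sum>k=1..d. (a k - a (k + 1)) * (\<Sum>m=1..k. x m))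
    = (\<Sum>k=1..d. a k * x k) - a (d + 1) * (\<Sum>m=1..d. x m)"
  by (induction d) (auto simp: algebra_simps)

text \<open>Gibbs variational inequality relative to the uniform law on \<open>A\<close>, with the
  logarithm of the normalized exponential mean already linearized by ln x \<le> x - 1. The right
  side is therefore linear in the exponential moments and can be integrated over the sample
  directly; \<open>c\<close> will be a bound for these moments.\<close>

lemma exp_Gibbs_bound:
  fixes p u :: "'a \<Rightarrow> real" and c :: real
  assumes fin: "finite A" "A \<noteq> {}" and p: "\<And>w. w \<in> A \<Longrightarrow> 0 < p w" "sum p A = 1" and c: "0 < c"
  shows "(\<Sum>w\<in>A. p w * (u w - ln (p w)))
    \<le> ln (card A) + ln c + (\<Sum>w\<in>A. exp (u w)) / (c * card A) - 1"
proof -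
  have N: "0 < real (card A)" using fin by (simp add: card_gt_0_iff)
  have pt: "p w * (u w - ln (p w)) \<le> p w * (ln (card A) + ln c) + exp (u w) / (c * card A) - p w"
    if "w \<in> A" for w
  proof -
    \<comment> \<open>Ratio of the tilted uniform weight to \<open>p w\<close>, normalized by
      \<open>c\<close>; averaging ln r \<le> r - 1 with weights \<open>p w\<close> gives the
      claim.\<close>
    define r where "r = exp (u w) / (c * card A * p w)"
    have r: "0 < r" using N c p(1)[OF that] by (simp add: r_def)
    have "ln r = u w - ln c - ln (card A) - ln (p w)"
      using N c p(1)[OF that] by (simp add: r_def ln_div ln_mult)
    moreover have "ln r \<le> r - 1" using r by (rule ln_le_minus_one)
    ultimately have "p w * (u w - ln (p w) - (ln (card A) + ln c)) \<le> p w * (r - 1)"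
      using p(1)[OF that] by (intro mult_left_mono) auto
    moreover have "p w * r = exp (u w) / (c * card A)"
      using p(1)[OF that] N c by (simp add: r_def field_simps)
    ultimately show ?thesis by (simp add: algebra_simps)
  qed
  have "(\<Sum>w\<in>A. p w * (u w - ln (p w)))
      \<le> (\<Sum>w\<in>A. p w * (ln (card A) + ln c) + exp (u w) / (c * card A) - p w)"
    by (intro sum_mono pt)
  also have "\<dots> = ln (card A) + ln c + (\<Sum>w\<in>A. exp (u w)) / (c * card A) - 1"
    using p(2) by (simp add: sum.distrib sum_subtractf sum_divide_distrib flip: sum_distrib_right)
  finally show ?thesis .
qed

section \<open>Integrals over product measures\<close>

lemma integrable_PiM_bounded:
  fixes h :: "('i \<Rightarrow> 'a) \<Rightarrow> real"
  assumes "\<And>i. i \<in> I \<Longrightarrow> prob_space (M i)" "h \<in> borel_measurable (Pi\<^sub>M I M)"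
    and "\<And>s. \<bar>h s\<bar> \<le> B"
  shows "integrable (Pi\<^sub>M I M) h"
proof -
  interpret prob_space "Pi\<^sub>M I M" using assms(1) by (rule prob_space_PiM)
  show ?thesis using assms by (intro integrable_const_bound[where B = B]) auto
qed

context prob_space
begin

lemma integral_PiM_coordinate:
  fixes h :: "'a \<Rightarrow> real"
  assumes "finite I" "i \<in> I" "integrable M h"
  shows "(\<integral>s. h (s i) \<partial>(\<Pi>\<^sub>M j\<in>I. M)) = (\<integral>x. h x \<partial>M)"
proof -
  have "distr (\<Pi>\<^sub>M j\<in>I. M) M (\<lambda>s. s i) = M"
    using assms prob_space_axioms by (intro distr_PiM_component) auto
  then show ?thesis
    using assms integral_distr[of "\<lambda>s. s i" "\<Pi>\<^sub>M j\<in>I. M" M h] by simp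
qed

text \<open>Fubini with coordinate \<open>i\<close> innermost: where \<open>z\<close> is nonzero the
  factor \<open>q\<close> does not see this coordinate, so it comes out of an integral of
  \<open>z\<close> that is 0. This stands in for the conditional independence of the points inside
  and outside a level.\<close>

lemma integral_PiM_mult_coordinate_eq_0:
  fixes q :: "('i \<Rightarrow> 'a) \<Rightarrow> real" and z :: "'a \<Rightarrow> real"
  assumes I: "finite I" "i \<in> I"
    and q: "q \<in> borel_measurable (\<Pi>\<^sub>M j\<in>I. M)" "\<And>s. \<bar>q s\<bar> \<le> B"
    and z: "z \<in> borel_measurable M" "\<And>x. \<bar>z x\<bar> \<le> C" "(\<integral>x. z x \<partial>M) = 0"
    and const: "\<And>s x y. z x \<noteq> 0 \<Longrightarrow> z y \<noteq> 0 \<Longrightarrow> q (s(i := x)) = q (s(i := y))"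
  shows "(\<integral>s. q s * z (s i) \<partial>(\<Pi>\<^sub>M j\<in>I. M)) = 0"
proof -
  interpret P: product_sigma_finite "\<lambda>_. M"
    by (simp add: product_sigma_finite.intro sigma_finite_measure_axioms)
  have insI: "insert i (I - {i}) = I" using I by auto
  have "integrable (\<Pi>\<^sub>M j\<in>I. M) (\<lambda>s. q s * z (s i))"
  proof (rule integrable_PiM_bounded[where B = "B * C"])
    show "\<bar>q s * z (s i)\<bar> \<le> B * C" for s
      unfolding abs_mult using q(2)[of s] z(2)[of "s i"] by (intro mult_mono) auto
    show "(\<lambda>s. q s * z (s i)) \<in> borel_measurable (\<Pi>\<^sub>M j\<in>I. M)"
      using q(1) z(1) I by measurable
  qed (rule prob_space_axioms)
  then have "(\<integral>s. q s * z (s i) \<partial>(\<Pi>\<^sub>M j\<in>I. M))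
      = (\<integral>s. (\<integral>x. q (s(i := x)) * z x \<partial>M) \<partial>(\<Pi>\<^sub>M j\<in>I-{i}. M))"
    using P.product_integral_insert[of "I - {i}" i "\<lambda>s. q s * z (s i)"] I
    by (simp add: insI del: insert_Diff_single)
  also have "(\<lambda>s. \<integral>x. q (s(i := x)) * z x \<partial>M) = (\<lambda>_. 0)"
  proof
    fix s
    show "(\<integral>x. q (s(i := x)) * z x \<partial>M) = 0"
    \<comment> \<open>One point \<open>y\<close> with \<open>z y\<close> nonzero fixes the value of
      \<open>q\<close>; where \<open>z\<close> vanishes the product is 0 whatever \<open>q\<close>
      is.\<close>
    proof (cases "\<exists>y. z y \<noteq> 0")
      case True
      then obtain y where "z y \<noteq> 0" by blast
      then have "q (s(i := x)) * z x = q (s(i := y)) * z x" for x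
        using const[of x y s] by (cases "z x = 0") auto
      then have "(\<integral>x. q (s(i := x)) * z x \<partial>M) = (\<integral>x. q (s(i := y)) * z x \<partial>M)"
        by (intro Bochner_Integration.integral_cong refl)
      then show ?thesis using z(3) by simp
    qed auto
  qed
  finally show ?thesis by simp
qed

text \<open>The exponential factors over the independent coordinates into \<open>n\<close> equal
  moments at parameter \<open>t / n\<close>, each bounded by Hoeffding's lemma; \<open>n\<close>
  copies of (t / n)^2 leave the factor 1 / n.\<close>

lemma Hoeffding_mgf_iid:
  fixes g :: "'a \<Rightarrow> real"
  assumes g: "g \<in> borel_measurable M" "\<And>x. g x \<in> {a..b}" and n: "0 < n" and t: "0 < t"
  shows "(\<integral>s. exp (t * ((\<integral>x. g x \<partial>M) - (\<Sum>i=1..n. g (s i)) / real n)) \<partial>(\<Pi>\<^sub>M i\<in>{1..n}. M))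
    \<le> exp (t\<^sup>2 * (b - a)\<^sup>2 / (8 * real n))"
proof -
  define l where "l = t / n"
  define h where "h x = exp (l * ((\<integral>x. g x \<partial>M) - g x))" for x
  have l: "0 < l" using n t by (simp add: l_def)
  \<comment> \<open>The function is negated because the exponent is the mean minus the observed
    value.\<close>
  interpret H: interval_bounded_random_variable M "\<lambda>x. - g x" "- b" "- a"
    using g by unfold_locales auto
  interpret P: product_sigma_finite "\<lambda>_. M"
    by (simp add: product_sigma_finite.intro sigma_finite_measure_axioms)
  have h_bound: "\<bar>h x\<bar> \<le> exp (l * (\<bar>\<integral>x. g x \<partial>M\<bar> + \<bar>a\<bar> + \<bar>b\<bar>))" for x
    using g(2)[of x] l by (auto simp: h_def intro!: mult_left_mono)
  have h_meas: "h \<in> borel_measurable M"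
    unfolding h_def using g(1) by measurable
  have h_int: "integrable M h"
    by (rule integrable_const_bound[OF _ h_meas]) (use h_bound in auto)
  have "ennreal (\<integral>x. h x \<partial>M) = (\<integral>\<^sup>+x. h x \<partial>M)"
    by (rule nn_integral_eq_integral[symmetric, OF h_int]) (simp add: h_def)
  also have "\<dots> \<le> ennreal (exp (l\<^sup>2 * (b - a)\<^sup>2 / 8))"
    using H.Hoeffdings_lemma_nn_integral[OF l]
    by (simp add: h_def power2_commute[of a b] add.commute)
  finally have "(\<integral>x. h x \<partial>M) \<le> exp (l\<^sup>2 * (b - a)\<^sup>2 / 8)"
    by simp
  moreover have "0 \<le> (\<integral>x. h x \<partial>M)" by (simp add: h_def)
  ultimately have "(\<integral>x. h x \<partial>M) ^ n \<le> exp (l\<^sup>2 * (b - a)\<^sup>2 / 8) ^ n"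
    by (intro power_mono)
  also have "\<dots> = exp (t\<^sup>2 * (b - a)\<^sup>2 / (8 * real n))"
    using n by (simp add: l_def power2_eq_square field_simps flip: exp_of_nat_mult)
  finally have "(\<integral>x. h x \<partial>M) ^ n \<le> exp (t\<^sup>2 * (b - a)\<^sup>2 / (8 * real n))" .
  moreover have "(\<integral>x. h x \<partial>M) ^ n = (\<integral>s. (\<Prod>i=1..n. h (s i)) \<partial>(\<Pi>\<^sub>M i\<in>{1..n}. M))"
    using P.product_integral_prod[of "{1..n}" "\<lambda>_. h"] h_int by simp
  moreover have "(\<Prod>i=1..n. h (s i)) = exp (t * ((\<integral>x. g x \<partial>M) - (\<Sum>i=1..n. g (s i)) / real n))" for s
  proof -
    have "(\<Prod>i=1..n. h (s i)) = exp (l * (real n * (\<integral>x. g x \<partial>M) - (\<Sum>i=1..n. g (s i))))"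
      by (simp add: h_def sum_subtractf flip: exp_sum sum_distrib_left)
    then show ?thesis using n by (simp add: l_def right_diff_distrib)
  qed
  ultimately show ?thesis by simp
qed

end


section \<open>Chains of Gibbs conditionals\<close>

text \<open>Intended reading: \<open>X k\<close> is the shell of level \<open>k\<close>,
  \<open>loss k\<close> the error there after the level-\<open>k\<close> correction and
  \<open>base k\<close> the error before it, so \<open>\<rho> k\<close> bounds the effect of one
  correction. \<open>base_cong\<close> stops below \<open>k\<close> while \<open>loss_cong\<close>
  includes \<open>k\<close>; this makes \<open>base k\<close> and the later \<open>center k\<close>
  blind to the parameter of level \<open>k\<close>.\<close>

locale gibbs_chain = prob_space M for M :: "'x measure" +
  fixes d n :: nat
    and W :: "nat \<Rightarrow> 'w set"
    and ref :: "nat \<Rightarrow> 'w"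
    and lam \<rho> :: "nat \<Rightarrow> real"
    and X :: "nat \<Rightarrow> 'x set"
    and loss base :: "nat \<Rightarrow> (nat \<Rightarrow> 'w) \<Rightarrow> 'x \<Rightarrow> real"
  assumes n_pos: "0 < n"
    and finite_W: "k \<in> {1..d} \<Longrightarrow> finite (W k)"
    and ref_in_W: "k \<in> {1..d} \<Longrightarrow> ref k \<in> W k"
    and lam_decreasing: "k \<in> {1..d} \<Longrightarrow> lam (k + 1) < lam k"
    and lam_last: "lam (d + 1) = 0"
    and X_sets: "k \<in> {1..d} \<Longrightarrow> X k \<in> sets M"
    and X_disjoint: "j < k \<Longrightarrow> x \<in> X k \<Longrightarrow> x \<notin> X j"
    and loss_measurable:
      "k \<in> {1..d} \<Longrightarrow> w \<in> Pi {1..k} W \<Longrightarrow> loss k w \<in> borel_measurable M"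
    and base_measurable:
      "k \<in> {1..d} \<Longrightarrow> w \<in> Pi {1..k} W \<Longrightarrow> base k w \<in> borel_measurable M"
    and loss_outside: "x \<notin> X k \<Longrightarrow> loss k w x = 0"
    and base_outside: "x \<notin> X k \<Longrightarrow> base k w x = 0"
    and loss_cong: "(\<And>m. m \<in> {1..k} \<Longrightarrow> w m = w' m) \<Longrightarrow> loss k w = loss k w'"
    and base_cong: "(\<And>m. m \<in> {1..<k} \<Longrightarrow> w m = w' m) \<Longrightarrow> base k w = base k w'"
    and loss_base: "k \<in> {1..d} \<Longrightarrow> w k \<in> W k \<Longrightarrow> \<bar>loss k w x - base k w x\<bar> \<le> \<rho> k"
begin

definition emp :: "('x \<Rightarrow> real) \<Rightarrow> (nat \<Rightarrow> 'x) \<Rightarrow> real" where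
  "emp g s = (\<Sum>i=1..n. g (s i)) / real n"

definition gibbs :: "nat \<Rightarrow> (nat \<Rightarrow> 'w) \<Rightarrow> (nat \<Rightarrow> 'x) \<Rightarrow> real" where
  "gibbs k w s = exp (- emp (loss k w) s / lam k) / (\<Sum>v\<in>W k. exp (- emp (loss k (w(k := v))) s / lam k))"

definition prefix_prob :: "nat \<Rightarrow> (nat \<Rightarrow> 'w) \<Rightarrow> (nat \<Rightarrow> 'x) \<Rightarrow> real" where
  "prefix_prob k w s = (\<Prod>m=1..k. gibbs m w s)"

abbreviation sample :: "(nat \<Rightarrow> 'x) measure" where
  "sample \<equiv> \<Pi>\<^sub>M i\<in>{1..n}. M"

abbreviation ref_at :: "nat \<Rightarrow> (nat \<Rightarrow> 'w) \<Rightarrow> nat \<Rightarrow> 'w" where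
  "ref_at k w \<equiv> w(k := ref k)"

text \<open>
  The loss of the reference parameter, recentered by \<open>base\<close>, depends on the parameters below level
  \<open>k\<close> only. Given the points outside \<open>X k\<close>, these are independent of the points in
  \<open>X k\<close>, so this loss may be replaced by its conditional mean on \<open>X k\<close>. The result is a
  centered loss whose range has width \<open>2 * \<rho> k\<close> and contains 0; the plain difference of the losses
  could range over an interval of width \<open>4 * \<rho> k\<close>. If \<open>X k\<close> is a null set, the
  division gives 0.
\<close>

definition center :: "nat \<Rightarrow> (nat \<Rightarrow> 'w) \<Rightarrow> real" where
  "center k w = (\<integral>x. loss k (ref_at k w) x - base k w x \<partial>M) / measure M (X k)"

definition centered_loss :: "nat \<Rightarrow> (nat \<Rightarrow> 'w) \<Rightarrow> 'x \<Rightarrow> real" where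
  "centered_loss k w x = loss k w x - base k w x - center k w * indicator (X k) x"

section \<open>Gibbs conditionals and prefix marginals\<close>

lemma lam_pos: assumes "k \<in> {1..d}" shows "0 < lam k"
proof -
  have "k \<le> d" using assms by simp
  then show ?thesis using assms
  \<comment> \<open>Downward from \<open>d\<close>, where lam d > lam (d + 1) = 0.\<close>
  proof (induction rule: inc_induct)
    case base
    then show ?case using lam_decreasing[of d] lam_last by simp
  next
    case (step m)
    then show ?case using lam_decreasing[of m] by simp
  qed
qed

lemma rho_nonneg: "k \<in> {1..d} \<Longrightarrow> 0 \<le> \<rho> k"
  using loss_base[of k ref] ref_in_W[of k] by (meson abs_ge_zero order_trans)

lemma sum_W_pos:
  assumes "k \<in> {1..d}" shows "0 < (\<Sum>v\<in>W k. exp (h v :: real))"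
  using assms finite_W ref_in_W by (intro sum_pos) auto

lemma gibbs_pos: "k \<in> {1..d} \<Longrightarrow> 0 < gibbs k w s"
  unfolding gibbs_def by (intro divide_pos_pos sum_W_pos) auto

lemma prefix_prob_pos: "k \<le> d \<Longrightarrow> 0 < prefix_prob k w s"
  unfolding prefix_prob_def by (intro prod_pos) (auto intro!: gibbs_pos)

lemma gibbs_cong:
  assumes "\<And>m. m \<in> {1..k} \<Longrightarrow> w m = w' m"
  shows "gibbs k w = gibbs k w'"
proof -
  have "loss k w = loss k w'" using assms by (rule loss_cong)
  moreover have "loss k (w(k := v)) = loss k (w'(k := v))" for v
    using assms by (intro loss_cong) auto
  ultimately show ?thesis by (intro ext) (simp only: gibbs_def)
qed

lemma prefix_prob_cong:
  assumes "\<And>m. m \<in> {1..k} \<Longrightarrow> w m = w' m"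
  shows "prefix_prob k w = prefix_prob k w'"
proof -
  have "gibbs j w = gibbs j w'" if "j \<in> {1..k}" for j
    using assms that by (intro gibbs_cong) auto
  then show ?thesis by (simp add: prefix_prob_def fun_eq_iff)
qed

lemma prefix_prob_Suc: "prefix_prob (Suc k) w s = prefix_prob k w s * gibbs (Suc k) w s"
  by (simp add: prefix_prob_def)

lemma gibbs_le_1:
  assumes "k \<in> {1..d}" "w k \<in> W k"
  shows "gibbs k w s \<le> 1"
proof -
  have "exp (- emp (loss k (w(k := w k))) s / lam k)
      \<le> (\<Sum>v\<in>W k. exp (- emp (loss k (w(k := v))) s / lam k))"
    by (rule member_le_sum) (use assms finite_W in auto)
  then show ?thesis using sum_W_pos[OF assms(1)] by (simp add: gibbs_def)
qed

lemma sum_gibbs: "k \<in> {1..d} \<Longrightarrow> (\<Sum>v\<in>W k. gibbs k (w(k := v)) s) = 1"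
  using sum_W_pos[of k "\<lambda>v. - emp (loss k (w(k := v))) s / lam k"]
  by (simp add: gibbs_def flip: sum_divide_distrib)

lemma sum_prefix_prob_Suc:
  assumes "Suc k \<le> d" and h: "\<And>w v. h (w(Suc k := v)) = (h w :: real)"
  shows "(\<Sum>w\<in>PiE {1..Suc k} W. prefix_prob (Suc k) w s * h w)
    = (\<Sum>w\<in>PiE {1..k} W. prefix_prob k w s * h w)"
proof -
  have "prefix_prob (Suc k) (w(Suc k := v)) s = prefix_prob k w s * gibbs (Suc k) (w(Suc k := v)) s" for w v
  proof -
    have "prefix_prob k (w(Suc k := v)) = prefix_prob k w" by (rule prefix_prob_cong) auto
    then show ?thesis by (simp add: prefix_prob_Suc)
  qed
  then have "(\<Sum>w\<in>PiE {1..Suc k} W. prefix_prob (Suc k) w s * h w)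
      = (\<Sum>w\<in>PiE {1..k} W. prefix_prob k w s * h w * (\<Sum>v\<in>W (Suc k). gibbs (Suc k) (w(Suc k := v)) s))"
    unfolding sum_PiE_Suc by (simp add: h sum_distrib_left mult_ac)
  then show ?thesis using sum_gibbs[of "Suc k"] assms by simp
qed

text \<open>Parameters above level \<open>k\<close> are summed out, each conditional mass function
  contributing 1. Hence \<open>prefix_prob k\<close> is the marginal law of the first
  \<open>k\<close> parameters given the sample.\<close>

lemma sum_prefix_prob_marginal:
  assumes "k \<le> d" and h: "\<And>w w'. (\<And>m. m \<in> {1..k} \<Longrightarrow> w m = w' m) \<Longrightarrow> h w = (h w' :: real)"
  shows "(\<Sum>w\<in>PiE {1..d} W. prefix_prob d w s * h w) = (\<Sum>w\<in>PiE {1..k} W. prefix_prob k w s * h w)"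
proof -
  have "j \<le> d \<Longrightarrow> (\<Sum>w\<in>PiE {1..j} W. prefix_prob j w s * h w)
      = (\<Sum>w\<in>PiE {1..k} W. prefix_prob k w s * h w)" if "k \<le> j" for j
    using that
  proof (induction rule: dec_induct)
    case (step j)
    have "h (w(Suc j := v)) = h w" for w v using step by (intro h) auto
    then show ?case using step sum_prefix_prob_Suc[of j h] by simp
  qed simp
  from this[of d] show ?thesis using assms(1) by simp
qed

lemma sum_prefix_prob:
  assumes "k \<le> d" shows "(\<Sum>w\<in>PiE {1..k} W. prefix_prob k w s) = 1"
  \<comment> \<open>The constant 1 is marginalized twice: to level 0, where the empty prefix has
    probability 1, and to level \<open>k\<close>.\<close>
  using sum_prefix_prob_marginal[of 0 "\<lambda>_. 1"] sum_prefix_prob_marginal[of k "\<lambda>_. 1"] assms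
  by (simp add: prefix_prob_def)

text \<open>The normalizing sum is at least its summand at \<open>ref k\<close>; taking logarithms
  and clearing the denominator \<open>lam k\<close> gives the bound.\<close>

lemma gibbs_ref_bound:
  assumes k: "k \<in> {1..d}"
  shows "emp (loss k w) s - emp (loss k (ref_at k w)) s \<le> - lam k * ln (gibbs k w s)"
proof -
  let ?e = "\<lambda>w. exp (- emp (loss k w) s / lam k)"
  have "?e (ref_at k w) \<le> (\<Sum>v\<in>W k. ?e (w(k := v)))"
    by (rule member_le_sum[of "ref k" "W k" "\<lambda>v. ?e (w(k := v))"]) (use k finite_W ref_in_W in auto)
  then have "ln (?e (ref_at k w)) \<le> ln (\<Sum>v\<in>W k. ?e (w(k := v)))"
    using sum_W_pos[OF k] by (subst ln_le_cancel_iff) auto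
  moreover have "ln (gibbs k w s) = - emp (loss k w) s / lam k - ln (\<Sum>v\<in>W k. ?e (w(k := v)))"
    unfolding gibbs_def using sum_W_pos[OF k, of "\<lambda>v. - emp (loss k (w(k := v))) s / lam k"]
    by (simp add: ln_div)
  ultimately have "ln (gibbs k w s) \<le> (emp (loss k (ref_at k w)) s - emp (loss k w) s) / lam k"
    by (simp add: diff_divide_distrib)
  then show ?thesis using lam_pos[OF k] by (simp add: field_simps)
qed

section \<open>The centered losses\<close>

lemma center_cong: "(\<And>m. m \<in> {1..<k} \<Longrightarrow> w m = w' m) \<Longrightarrow> center k w = center k w'"
proof -
  assume a: "\<And>m. m \<in> {1..<k} \<Longrightarrow> w m = w' m"
  have "base k w = base k w'" using a by (rule base_cong)
  \<comment> \<open>\<open>ref_at\<close> overwrites coordinate \<open>k\<close>, so agreement below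
    \<open>k\<close> suffices.\<close>
  moreover have "loss k (ref_at k w) = loss k (ref_at k w')" using a by (intro loss_cong) auto
  ultimately show ?thesis by (simp add: center_def)
qed

lemma centered_loss_cong:
  assumes "\<And>m. m \<in> {1..k} \<Longrightarrow> w m = w' m" shows "centered_loss k w = centered_loss k w'"
proof -
  have "base k w = base k w'" "center k w = center k w'" "loss k w = loss k w'"
    using assms by (auto intro!: base_cong center_cong loss_cong)
  then show ?thesis by (simp add: centered_loss_def fun_eq_iff)
qed

lemma centered_loss_outside: "x \<notin> X k \<Longrightarrow> centered_loss k w x = 0"
  by (simp add: centered_loss_def loss_outside base_outside)

lemma
  shows base_ref: "base k (ref_at k w) = base k w"
    and center_ref: "center k (ref_at k w) = center k w"
  by (auto intro!: base_cong center_cong)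

text \<open>The recentering terms read only parameters below \<open>k\<close>, so they cancel in the
  difference.\<close>

lemma emp_loss_diff:
  "emp (loss k w) s - emp (loss k (ref_at k w)) s = emp (centered_loss k w) s - emp (centered_loss k (ref_at k w)) s"
  by (simp add: emp_def centered_loss_def base_ref center_ref sum_subtractf diff_divide_distrib)

lemma centered_loss_measurable:
  assumes "k \<in> {1..d}" "w \<in> Pi {1..k} W" shows "centered_loss k w \<in> borel_measurable M"
proof -
  note [measurable] = loss_measurable[OF assms] base_measurable[OF assms] X_sets[OF assms(1)]
  show ?thesis unfolding centered_loss_def by measurable
qed

text \<open>The factor \<open>measure M (X k)\<close> comes from both losses vanishing off
  \<open>X k\<close>; it is what keeps the conditional mean \<open>center k w\<close> within
  \<open>\<rho> k\<close>.\<close>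

lemma integral_ref_loss:
  assumes k: "k \<in> {1..d}" and w: "w \<in> Pi {1..k} W"
  shows "\<bar>\<integral>x. loss k (ref_at k w) x - base k w x \<partial>M\<bar> \<le> \<rho> k * measure M (X k)"
    and "integrable M (\<lambda>x. loss k (ref_at k w) x - base k w x)"
proof -
  let ?v = "\<lambda>x. loss k (ref_at k w) x - base k w x"
  have rw: "ref_at k w \<in> Pi {1..k} W" using w ref_in_W[OF k] by auto
  have v_le: "\<bar>?v x\<bar> \<le> \<rho> k * indicator (X k) x" for x
    using loss_base[of k "ref_at k w" x] k ref_in_W base_ref
    by (auto simp: indicator_def loss_outside base_outside)
  have meas: "?v \<in> borel_measurable M"
    using loss_measurable[OF k rw] base_measurable[OF k w] by measurable
  have int: "integrable M (\<lambda>x. \<rho> k * indicator (X k) x)"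
    using X_sets[OF k] by (intro integrable_real_mult_indicator) auto
  show v_int: "integrable M ?v"
    by (rule Bochner_Integration.integrable_bound[OF int meas]) (auto intro!: order_trans[OF v_le abs_ge_self])
  have "\<bar>\<integral>x. ?v x \<partial>M\<bar> \<le> (\<integral>x. \<bar>?v x\<bar> \<partial>M)" by (rule integral_abs_bound)
  also have "\<dots> \<le> (\<integral>x. \<rho> k * indicator (X k) x \<partial>M)"
    using v_int int v_le by (intro integral_mono) auto
  also have "\<dots> = \<rho> k * measure M (X k)" using X_sets[OF k] by simp
  finally show "\<bar>\<integral>x. ?v x \<partial>M\<bar> \<le> \<rho> k * measure M (X k)" .
qed

lemma center_bound:
  assumes "k \<in> {1..d}" "w \<in> Pi {1..k} W" shows "\<bar>center k w\<bar> \<le> \<rho> k"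
proof (cases "measure M (X k) = 0")
  case False
  then have "0 < measure M (X k)" by (simp add: zero_less_measure_iff)
  then show ?thesis using integral_ref_loss(1)[OF assms] by (simp add: center_def divide_le_eq)
qed (use rho_nonneg assms in \<open>simp add: center_def\<close>)

text \<open>Off \<open>X k\<close> the value is 0, which belongs to the interval because the center
  is at most \<open>\<rho> k\<close> in absolute value.\<close>

lemma centered_loss_range:
  assumes "k \<in> {1..d}" "w \<in> Pi {1..k} W"
  shows "centered_loss k w x \<in> {- \<rho> k - center k w..\<rho> k - center k w}"
proof (cases "x \<in> X k")
  case True
  then show ?thesis using loss_base[of k w x] assms by (auto simp: centered_loss_def Pi_def abs_le_iff)
next
  case False
  then show ?thesis using center_bound[OF assms] by (auto simp: centered_loss_outside abs_le_iff)
qed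

lemma centered_loss_bound:
  assumes "k \<in> {1..d}" "w \<in> Pi {1..k} W" shows "\<bar>centered_loss k w x\<bar> \<le> 2 * \<rho> k"
  using centered_loss_range[OF assms, of x] center_bound[OF assms] by (auto simp: abs_le_iff)

lemma centered_loss_integrable:
  assumes "k \<in> {1..d}" "w \<in> Pi {1..k} W" shows "integrable M (centered_loss k w)"
  using centered_loss_bound[OF assms] centered_loss_measurable[OF assms]
  by (intro integrable_const_bound[where B = "2 * \<rho> k"]) auto

lemma integral_centered_loss_ref:
  assumes k: "k \<in> {1..d}" and w: "w \<in> Pi {1..k} W"
  shows "(\<integral>x. centered_loss k (ref_at k w) x \<partial>M) = 0"
proof -
  have "(\<integral>x. centered_loss k (ref_at k w) x \<partial>M)
      = (\<integral>x. loss k (ref_at k w) x - base k w x \<partial>M) - center k w * measure M (X k)"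
    using integral_ref_loss(2)[OF k w] X_sets[OF k]
    by (simp add: centered_loss_def base_ref center_ref less_top[symmetric])
  also have "\<dots> = 0"
    \<comment> \<open>If \<open>X k\<close> is a null set, the center is 0 through division by 0,
      and the bound forces the integral to be 0 as well.\<close>
    using integral_ref_loss(1)[OF k w] by (cases "measure M (X k) = 0") (auto simp: center_def)
  finally show ?thesis .
qed


section \<open>Averages over the sample\<close>

lemma emp_measurable [measurable]:
  assumes "g \<in> borel_measurable M" shows "emp g \<in> borel_measurable sample"
  using assms unfolding emp_def by measurable

lemma gibbs_measurable:
  assumes k: "k \<in> {1..d}" and w: "w \<in> Pi {1..k} W"
  shows "gibbs k w \<in> borel_measurable sample"
proof -
  have [measurable]: "loss k (w(k := v)) \<in> borel_measurable M" if "v \<in> W k" for v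
    using that w by (intro loss_measurable[OF k]) auto
  note [measurable] = loss_measurable[OF k w]
  show ?thesis unfolding gibbs_def by measurable
qed

lemma prefix_prob_measurable:
  assumes "k \<le> d" "w \<in> Pi {1..k} W" shows "prefix_prob k w \<in> borel_measurable sample"
  unfolding prefix_prob_def
  by (intro borel_measurable_prod gibbs_measurable) (use assms in auto)

lemma prefix_prob_le_1:
  assumes "k \<le> d" "w \<in> Pi {1..k} W" shows "prefix_prob k w s \<le> 1"
  unfolding prefix_prob_def
proof (rule prod_le_1)
  fix m assume m: "m \<in> {1..k}"
  then have "w m \<in> W m" using assms(2) by (rule Pi_mem[rotated])
  then show "0 \<le> gibbs m w s \<and> gibbs m w s \<le> 1"
    using assms(1) m gibbs_pos[of m w s] gibbs_le_1[of m w s] by auto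
qed

lemma prefix_prob_abs_le_1:
  assumes "k \<le> d" "w \<in> Pi {1..k} W" shows "\<bar>prefix_prob k w s\<bar> \<le> 1"
  using prefix_prob_le_1[OF assms, of s] prefix_prob_pos[OF assms(1), of w s] by simp

text \<open>By disjointness \<open>x\<close> and \<open>y\<close> lie outside \<open>X m\<close>,
  where \<open>loss m\<close> is 0: lower levels do not notice a point moving within
  \<open>X k\<close>.\<close>

lemma gibbs_update_sample:
  assumes "m < k" "x \<in> X k" "y \<in> X k" shows "gibbs m w (s(i := x)) = gibbs m w (s(i := y))"
proof -
  have "loss m w' ((s(i := x)) j) = loss m w' ((s(i := y)) j)" for w' j
    using assms X_disjoint[of m k] by (auto simp: loss_outside)
  then show ?thesis by (simp add: gibbs_def emp_def)
qed

text \<open>The learned prefix is correlated with the sample, but its probability is unchanged when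
  a point moves within \<open>X k\<close>, the only place where the centered reference loss can be
  nonzero. As this loss has mean 0, each sample point contributes 0.\<close>

lemma integral_prefix_prob_mult_ref:
  assumes k: "k \<in> {1..d}" and w: "w \<in> Pi {1..k - 1} W"
  shows "(\<integral>s. prefix_prob (k - 1) w s * emp (centered_loss k (ref_at k w)) s \<partial>sample) = 0"
proof -
  let ?z = "centered_loss k (ref_at k w)"
  have rw: "ref_at k w \<in> Pi {1..k} W" using w ref_in_W[OF k] by (auto simp: Pi_def)
  have kd: "k - 1 \<le> d" using k by auto
  have int: "integrable sample (\<lambda>s. prefix_prob (k - 1) w s * ?z (s i))" if "i \<in> {1..n}" for i
  proof (rule integrable_PiM_bounded[where B = "1 * (2 * \<rho> k)"])
    show "\<bar>prefix_prob (k - 1) w s * ?z (s i)\<bar> \<le> 1 * (2 * \<rho> k)" for s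
      unfolding abs_mult
      by (rule mult_mono) (use prefix_prob_abs_le_1[OF kd w, of s] centered_loss_bound[OF k rw] in auto)
    show "(\<lambda>s. prefix_prob (k - 1) w s * ?z (s i)) \<in> borel_measurable sample"
      using prefix_prob_measurable[OF kd w] centered_loss_measurable[OF k rw] that by measurable
  qed (rule prob_space_axioms)
  have "(\<integral>s. prefix_prob (k - 1) w s * ?z (s i) \<partial>sample) = 0" if "i \<in> {1..n}" for i
  proof (rule integral_PiM_mult_coordinate_eq_0[OF _ that prefix_prob_measurable[OF kd w]
        prefix_prob_abs_le_1[OF kd w] centered_loss_measurable[OF k rw] centered_loss_bound[OF k rw]])
    show "(\<integral>x. ?z x \<partial>M) = 0" using integral_centered_loss_ref[OF k rw] by simp
    fix s x y assume "?z x \<noteq> 0" "?z y \<noteq> 0"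
    then have "x \<in> X k" "y \<in> X k" using centered_loss_outside by blast+
    then show "prefix_prob (k - 1) w (s(i := x)) = prefix_prob (k - 1) w (s(i := y))"
      unfolding prefix_prob_def by (intro prod.cong refl gibbs_update_sample) auto
  qed simp
  moreover have "(\<integral>s. prefix_prob (k - 1) w s * emp ?z s \<partial>sample)
      = (\<Sum>i=1..n. \<integral>s. prefix_prob (k - 1) w s * ?z (s i) \<partial>sample) / n"
    using int by (simp add: emp_def sum_distrib_left)
  ultimately show ?thesis by simp
qed

lemma emp_abs_le:
  assumes "\<And>x. \<bar>g x\<bar> \<le> B" shows "\<bar>emp g s\<bar> \<le> B"
proof -
  have "\<bar>\<Sum>i=1..n. g (s i)\<bar> \<le> (\<Sum>i=1..n. B)"
    by (rule order_trans[OF sum_abs]) (intro sum_mono assms)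
  then show ?thesis using n_pos by (simp add: emp_def field_simps)
qed

lemma emp_centered_loss_bound:
  assumes "k \<in> {1..d}" "w \<in> Pi {1..k} W" shows "\<bar>emp (centered_loss k w) s\<bar> \<le> 2 * \<rho> k"
  by (intro emp_abs_le centered_loss_bound assms)

lemma emp_centered_loss_integrable:
  assumes k: "k \<in> {1..d}" and w: "w \<in> Pi {1..k} W" shows "integrable sample (emp (centered_loss k w))"
  by (rule integrable_PiM_bounded[OF prob_space_axioms emp_measurable[OF centered_loss_measurable[OF assms]]
        emp_centered_loss_bound[OF assms]])

lemma integral_emp_centered_loss:
  assumes k: "k \<in> {1..d}" and w: "w \<in> Pi {1..k} W"
  shows "(\<integral>s. emp (centered_loss k w) s \<partial>sample) = (\<integral>x. centered_loss k w x \<partial>M)"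
proof -
  have "integrable sample (\<lambda>s. centered_loss k w (s i))" if "i \<in> {1..n}" for i
    using centered_loss_bound[OF assms] centered_loss_measurable[OF assms] that
    by (intro integrable_PiM_bounded[where B = "2 * \<rho> k"]) (auto intro: prob_space_axioms)
  then have "(\<integral>s. emp (centered_loss k w) s \<partial>sample) = (\<Sum>i=1..n. \<integral>s. centered_loss k w (s i) \<partial>sample) / n"
    by (simp add: emp_def)
  also have "(\<Sum>i=1..n. \<integral>s. centered_loss k w (s i) \<partial>sample) = (\<Sum>i=1..n. \<integral>x. centered_loss k w x \<partial>M)"
    by (intro sum.cong refl integral_PiM_coordinate centered_loss_integrable assms) auto
  finally show ?thesis using n_pos by simp
qed

text \<open>The centered reference terms have mean 0, so only population means of centered losses
  are left of the chained risk.\<close>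

lemma integral_emp_loss_diff:
  assumes w: "w \<in> Pi {1..d} W"
  shows "(\<integral>s. (\<Sum>k=1..d. emp (loss k w) s - emp (loss k (ref_at k w)) s) \<partial>sample)
    = (\<Sum>k=1..d. \<integral>x. centered_loss k w x \<partial>M)"
proof -
  have "integrable sample (\<lambda>s. emp (centered_loss k w) s - emp (centered_loss k (ref_at k w)) s)"
    and "(\<integral>s. emp (centered_loss k w) s - emp (centered_loss k (ref_at k w)) s \<partial>sample) = (\<integral>x. centered_loss k w x \<partial>M)"
    if k: "k \<in> {1..d}" for k
  proof -
    have wk: "w \<in> Pi {1..k} W" using w k by auto
    then have rw: "ref_at k w \<in> Pi {1..k} W" using ref_in_W[OF k] by auto
    note int = emp_centered_loss_integrable[OF k wk] emp_centered_loss_integrable[OF k rw]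
    show "integrable sample (\<lambda>s. emp (centered_loss k w) s - emp (centered_loss k (ref_at k w)) s)"
      using int by auto
    show "(\<integral>s. emp (centered_loss k w) s - emp (centered_loss k (ref_at k w)) s \<partial>sample) = (\<integral>x. centered_loss k w x \<partial>M)"
      using int integral_emp_centered_loss[OF k wk] integral_emp_centered_loss[OF k rw] integral_centered_loss_ref[OF k wk]
      by simp
  qed
  then show ?thesis unfolding emp_loss_diff
    by (subst Bochner_Integration.integral_sum) auto
qed

section \<open>Exponential moments of the generalization gap\<close>

definition gap :: "nat \<Rightarrow> real" where
  "gap k = lam k - lam (k + 1)"

lemma gap_pos: "k \<in> {1..d} \<Longrightarrow> 0 < gap k"
  using lam_decreasing by (simp add: gap_def)

text \<open>The factor \<open>1 / gap k\<close> is the inverse temperature: multiplying back by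
  \<open>gap k\<close> gives the log-probabilities of prefixes exactly the weight that Abel
  summation produces.\<close>

definition deviation :: "nat \<Rightarrow> (nat \<Rightarrow> 'w) \<Rightarrow> (nat \<Rightarrow> 'x) \<Rightarrow> real" where
  "deviation k w s = 1 / gap k * ((\<integral>x. centered_loss k w x \<partial>M) - emp (centered_loss k w) s)"

lemma exp_deviation:
  assumes k: "k \<in> {1..d}" and w: "w \<in> Pi {1..k} W"
  shows "integrable sample (\<lambda>s. exp (deviation k w s))"
    and "(\<integral>s. exp (deviation k w s) \<partial>sample) \<le> exp ((\<rho> k)\<^sup>2 / (2 * real n * (gap k)\<^sup>2))"
proof -
  show "integrable sample (\<lambda>s. exp (deviation k w s))"
  proof (rule integrable_PiM_bounded[where B = "exp (1 / gap k * (\<bar>\<integral>x. centered_loss k w x \<partial>M\<bar> + 2 * \<rho> k))"])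
    show "(\<lambda>s. exp (deviation k w s)) \<in> borel_measurable sample"
      unfolding deviation_def using centered_loss_measurable[OF assms] by measurable
    show "\<bar>exp (deviation k w s)\<bar> \<le> exp (1 / gap k * (\<bar>\<integral>x. centered_loss k w x \<partial>M\<bar> + 2 * \<rho> k))" for s
      using emp_centered_loss_bound[OF assms, of s] gap_pos[OF k]
      unfolding deviation_def abs_exp_cancel exp_le_cancel_iff by (intro mult_left_mono) auto
  qed (rule prob_space_axioms)
  \<comment> \<open>Here t = 1 / gap k. The center cancels from the width 2 \<rho> of the interval,
    and (2 \<rho>)^2 / 8 = \<rho>^2 / 2.\<close>
  have "(\<integral>s. exp (deviation k w s) \<partial>sample)
      \<le> exp ((1 / gap k)\<^sup>2 * ((\<rho> k - center k w) - (- \<rho> k - center k w))\<^sup>2 / (8 * real n))"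
    unfolding deviation_def emp_def
    by (rule Hoeffding_mgf_iid) (use centered_loss_measurable[OF assms] centered_loss_range[OF assms] n_pos gap_pos[OF k] in auto)
  also have "\<dots> = exp ((\<rho> k)\<^sup>2 / (2 * real n * (gap k)\<^sup>2))"
    by (simp add: power_divide power2_eq_square)
  finally show "(\<integral>s. exp (deviation k w s) \<partial>sample) \<le> exp ((\<rho> k)\<^sup>2 / (2 * real n * (gap k)\<^sup>2))" .
qed

abbreviation prefixes :: "nat \<Rightarrow> (nat \<Rightarrow> 'w) set" where
  "prefixes k \<equiv> PiE {1..k} W"

lemma finite_prefixes: "k \<le> d \<Longrightarrow> finite (prefixes k)"
  using finite_W by (intro finite_PiE) auto

lemma prefixes_nonempty: "k \<le> d \<Longrightarrow> prefixes k \<noteq> {}"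
proof -
  assume "k \<le> d"
  then have "restrict ref {1..k} \<in> prefixes k" using ref_in_W by auto
  then show ?thesis by blast
qed

lemma ln_card_prefixes: "k \<le> d \<Longrightarrow> ln (card (prefixes k)) = (\<Sum>m=1..k. ln (real (card (W m))))"
proof -
  assume "k \<le> d"
  then have "0 < real (card (W m))" if "m \<in> {1..k}" for m
    using that finite_W[of m] ref_in_W[of m] by (auto simp: card_gt_0_iff)
  then show ?thesis by (simp add: card_PiE) (subst ln_prod, auto)
qed

text \<open>The exponential moment under the uniform law on prefixes, divided by its Hoeffding bound
  so that its expectation is at most 1.\<close>

definition mgf_mean :: "nat \<Rightarrow> (nat \<Rightarrow> 'x) \<Rightarrow> real" where
  "mgf_mean k s = (\<Sum>w\<in>prefixes k. exp (deviation k w s))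
     / (exp ((\<rho> k)\<^sup>2 / (2 * real n * (gap k)\<^sup>2)) * card (prefixes k))"

lemma mgf_mean:
  assumes k: "k \<in> {1..d}"
  shows "integrable sample (mgf_mean k)" and "(\<integral>s. mgf_mean k s \<partial>sample) \<le> 1"
proof -
  have mem: "w \<in> Pi {1..k} W" if "w \<in> prefixes k" for w using that by auto
  have N: "0 < real (card (prefixes k))"
    using k finite_prefixes[of k] prefixes_nonempty[of k] by (auto simp: card_gt_0_iff)
  show "integrable sample (mgf_mean k)"
    unfolding mgf_mean_def using exp_deviation(1)[OF k mem] by auto
  have "(\<Sum>w\<in>prefixes k. \<integral>s. exp (deviation k w s) \<partial>sample)
      \<le> (\<Sum>w\<in>prefixes k. exp ((\<rho> k)\<^sup>2 / (2 * real n * (gap k)\<^sup>2)))"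
    by (intro sum_mono exp_deviation(2)[OF k mem])
  then show "(\<integral>s. mgf_mean k s \<partial>sample) \<le> 1"
    unfolding mgf_mean_def using exp_deviation(1)[OF k mem] N by (simp add: mult.commute)
qed

text \<open>Both terms read only the first \<open>k\<close> parameters, so the sum reduces to
  prefixes of length \<open>k\<close>, where \<open>exp_Gibbs_bound\<close> applies with
  \<open>c\<close> the Hoeffding bound. This is pointwise in the sample; the remainder
  \<open>mgf_mean k s - 1\<close> has expectation at most 0.\<close>

lemma sum_prefix_prob_deviation:
  assumes k: "k \<in> {1..d}"
  shows "(\<Sum>w\<in>prefixes d. prefix_prob d w s * (deviation k w s - ln (prefix_prob k w s)))
    \<le> (\<Sum>m=1..k. ln (real (card (W m)))) + (\<rho> k)\<^sup>2 / (2 * real n * (gap k)\<^sup>2) + mgf_mean k s - 1"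
proof -
  have kd: "k \<le> d" using k by simp
  have "deviation k w s - ln (prefix_prob k w s) = deviation k w' s - ln (prefix_prob k w' s)"
    if "\<And>m. m \<in> {1..k} \<Longrightarrow> w m = w' m" for w w'
    using centered_loss_cong[OF that] prefix_prob_cong[OF that] by (simp add: deviation_def)
  then have "(\<Sum>w\<in>prefixes d. prefix_prob d w s * (deviation k w s - ln (prefix_prob k w s)))
      = (\<Sum>w\<in>prefixes k. prefix_prob k w s * (deviation k w s - ln (prefix_prob k w s)))"
    by (rule sum_prefix_prob_marginal[OF kd])
  also have "\<dots> \<le> ln (card (prefixes k)) + ln (exp ((\<rho> k)\<^sup>2 / (2 * real n * (gap k)\<^sup>2))) + mgf_mean k s - 1"
    unfolding mgf_mean_def
    by (rule exp_Gibbs_bound[OF finite_prefixes[OF kd] prefixes_nonempty[OF kd]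
          prefix_prob_pos[OF kd] sum_prefix_prob[OF kd] exp_gt_zero])
  finally show ?thesis unfolding ln_card_prefixes[OF kd] ln_exp .
qed

section \<open>The reference terms under the learned law\<close>

definition ref_noise :: "nat \<Rightarrow> (nat \<Rightarrow> 'x) \<Rightarrow> real" where
  "ref_noise k s = (\<Sum>w\<in>prefixes d. prefix_prob d w s * emp (centered_loss k (ref_at k w)) s)"

text \<open>The centered reference loss does not read parameters from level \<open>k\<close> on, so
  only prefixes of length \<open>k - 1\<close> matter, and
  \<open>integral_prefix_prob_mult_ref\<close> applies to each.\<close>

lemma ref_noise:
  assumes k: "k \<in> {1..d}"
  shows "integrable sample (ref_noise k)" and "(\<integral>s. ref_noise k s \<partial>sample) = 0"
proof -
  have kd: "k - 1 \<le> d" using k by auto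
  have eq: "ref_noise k s = (\<Sum>w\<in>prefixes (k - 1). prefix_prob (k - 1) w s * emp (centered_loss k (ref_at k w)) s)" for s
    unfolding ref_noise_def
  proof (rule sum_prefix_prob_marginal[OF kd])
    fix w w' :: "nat \<Rightarrow> 'w" assume "\<And>m. m \<in> {1..k - 1} \<Longrightarrow> w m = w' m"
    then have "centered_loss k (ref_at k w) = centered_loss k (ref_at k w')" by (intro centered_loss_cong) auto
    then show "emp (centered_loss k (ref_at k w)) s = emp (centered_loss k (ref_at k w')) s" by simp
  qed
  have int: "integrable sample (\<lambda>s. prefix_prob (k - 1) w s * emp (centered_loss k (ref_at k w)) s)"
    if "w \<in> prefixes (k - 1)" for w
  proof (rule integrable_PiM_bounded[where B = "1 * (2 * \<rho> k)"])
    have w: "w \<in> Pi {1..k - 1} W" using that by auto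
    then have rw: "ref_at k w \<in> Pi {1..k} W" using ref_in_W[OF k] by (auto simp: Pi_def)
    show "\<bar>prefix_prob (k - 1) w s * emp (centered_loss k (ref_at k w)) s\<bar> \<le> 1 * (2 * \<rho> k)" for s
      unfolding abs_mult
      by (rule mult_mono)
        (use prefix_prob_abs_le_1[OF kd w, of s] emp_centered_loss_bound[OF k rw] in auto)
    show "(\<lambda>s. prefix_prob (k - 1) w s * emp (centered_loss k (ref_at k w)) s) \<in> borel_measurable sample"
      using prefix_prob_measurable[OF kd w] centered_loss_measurable[OF k rw] by measurable
  qed (rule prob_space_axioms)
  show "integrable sample (ref_noise k)" using int by (simp add: eq[abs_def])
  have "(\<integral>s. prefix_prob (k - 1) w s * emp (centered_loss k (ref_at k w)) s \<partial>sample) = 0"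
    if "w \<in> prefixes (k - 1)" for w
    using that by (intro integral_prefix_prob_mult_ref k) auto
  then show "(\<integral>s. ref_noise k s \<partial>sample) = 0"
    unfolding eq using int by (subst Bochner_Integration.integral_sum) auto
qed

section \<open>Assembling the risk bound\<close>

lemma sum_prefix_prob_risk_le:
  "(\<Sum>w\<in>prefixes d. prefix_prob d w s * (\<Sum>k=1..d. \<integral>x. centered_loss k w x \<partial>M))
    \<le> (\<Sum>k=1..d. ref_noise k s + gap k * ((\<Sum>m=1..k. ln (real (card (W m))))
         + (\<rho> k)\<^sup>2 / (2 * real n * (gap k)\<^sup>2) + mgf_mean k s - 1))"
proof -
  let ?e = "\<lambda>k w. emp (centered_loss k (ref_at k w)) s"
  let ?D = "\<lambda>k w. deviation k w s - ln (prefix_prob k w s)"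
  have le: "(\<Sum>k=1..d. \<integral>x. centered_loss k w x \<partial>M) \<le> (\<Sum>k=1..d. ?e k w + gap k * ?D k w)" for w
  proof -
    \<comment> \<open>The population mean is the empirical mean plus \<open>gap k\<close> times the
      deviation; \<open>gibbs_ref_bound\<close> trades the empirical mean for that of the reference
      at the cost of a log-probability.\<close>
    have "(\<integral>x. centered_loss k w x \<partial>M) \<le> ?e k w + gap k * deviation k w s - lam k * ln (gibbs k w s)"
      if k: "k \<in> {1..d}" for k
      using gibbs_ref_bound[OF k, of w s] gap_pos[OF k] by (simp add: emp_loss_diff deviation_def)
    then have "(\<Sum>k=1..d. \<integral>x. centered_loss k w x \<partial>M)
        \<le> (\<Sum>k=1..d. ?e k w + gap k * deviation k w s - lam k * ln (gibbs k w s))"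
      by (intro sum_mono)
    also have "\<dots> = (\<Sum>k=1..d. ?e k w + gap k * deviation k w s) - (\<Sum>k=1..d. lam k * ln (gibbs k w s))"
      by (rule sum_subtractf)
    \<comment> \<open>Abel summation; the boundary term disappears because lam (d + 1) = 0.\<close>
    also have "(\<Sum>k=1..d. lam k * ln (gibbs k w s)) = (\<Sum>k=1..d. gap k * (\<Sum>m=1..k. ln (gibbs m w s)))"
      using sum_diff_times_partial_sums[of lam "\<lambda>m. ln (gibbs m w s)" d] lam_last by (simp add: gap_def)
    also have "\<dots> = (\<Sum>k=1..d. gap k * ln (prefix_prob k w s))"
    proof (intro sum.cong refl)
      fix k assume "k \<in> {1..d}"
      then have "0 < gibbs m w s" if "m \<in> {1..k}" for m
        using that by (intro gibbs_pos) auto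
      then have "ln (prefix_prob k w s) = (\<Sum>m=1..k. ln (gibbs m w s))"
        unfolding prefix_prob_def by (intro ln_prod) (auto simp: less_le)
      then show "gap k * (\<Sum>m=1..k. ln (gibbs m w s)) = gap k * ln (prefix_prob k w s)" by simp
    qed
    finally show ?thesis by (simp only: sum_subtractf right_diff_distrib add_diff_eq)
  qed
  have "(\<Sum>w\<in>prefixes d. prefix_prob d w s * (\<Sum>k=1..d. \<integral>x. centered_loss k w x \<partial>M))
      \<le> (\<Sum>w\<in>prefixes d. prefix_prob d w s * (\<Sum>k=1..d. ?e k w + gap k * ?D k w))"
    by (intro sum_mono mult_left_mono le less_imp_le prefix_prob_pos order_refl)
  also have "\<dots> = (\<Sum>k=1..d. \<Sum>w\<in>prefixes d. prefix_prob d w s * (?e k w + gap k * ?D k w))"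
    unfolding sum_distrib_left by (rule sum.swap)
  also have "\<dots> = (\<Sum>k=1..d. ref_noise k s + gap k * (\<Sum>w\<in>prefixes d. prefix_prob d w s * ?D k w))"
    by (simp only: ref_noise_def distrib_left sum.distrib sum_distrib_left mult.left_commute)
  \<comment> \<open>Deviation and prefix log-probability now share the coefficient
    \<open>gap k\<close>, so the variational bound applies level by level.\<close>
  also have "\<dots> \<le> (\<Sum>k=1..d. ref_noise k s + gap k * ((\<Sum>m=1..k. ln (real (card (W m))))
         + (\<rho> k)\<^sup>2 / (2 * real n * (gap k)\<^sup>2) + mgf_mean k s - 1))"
    by (intro sum_mono add_left_mono mult_left_mono sum_prefix_prob_deviation)
      (auto intro!: less_imp_le[OF gap_pos])
  finally show ?thesis .
qed

text \<open>After integration the reference noise vanishes and the -1 absorbs the mean of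
  \<open>mgf_mean\<close>. The logarithms carry the factor 1 here.\<close>

theorem expected_risk_le:
  "(\<integral>s. (\<Sum>w\<in>prefixes d. prefix_prob d w s * (\<Sum>k=1..d. \<integral>x. centered_loss k w x \<partial>M)) \<partial>sample)
    \<le> (\<Sum>k=1..d. gap k * (\<Sum>m=1..k. ln (real (card (W m)))) + (\<rho> k)\<^sup>2 / (2 * real n * gap k))"
proof -
  interpret S: prob_space sample by (intro prob_space_PiM prob_space_axioms)
  let ?c = "\<lambda>k. (\<Sum>m=1..k. ln (real (card (W m)))) + (\<rho> k)\<^sup>2 / (2 * real n * (gap k)\<^sup>2)"
  have int_k: "integrable sample (\<lambda>s. ref_noise k s + gap k * (?c k + mgf_mean k s - 1))"
    and le_k: "(\<integral>s. ref_noise k s + gap k * (?c k + mgf_mean k s - 1) \<partial>sample)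
      \<le> gap k * (\<Sum>m=1..k. ln (real (card (W m)))) + (\<rho> k)\<^sup>2 / (2 * real n * gap k)"
    if k: "k \<in> {1..d}" for k
  proof -
    note int = ref_noise(1)[OF k] mgf_mean(1)[OF k]
    show "integrable sample (\<lambda>s. ref_noise k s + gap k * (?c k + mgf_mean k s - 1))"
      using int by (intro Bochner_Integration.integrable_add integrable_mult_right
          Bochner_Integration.integrable_diff S.integrable_const)
    have "(\<integral>s. ref_noise k s + gap k * (?c k + mgf_mean k s - 1) \<partial>sample)
        = gap k * (?c k + (\<integral>s. mgf_mean k s \<partial>sample) - 1)"
      using int ref_noise(2)[OF k] S.prob_space by (simp del: One_nat_def)
    also have "\<dots> \<le> gap k * ?c k"
      using mgf_mean(2)[OF k] gap_pos[OF k] by (intro mult_left_mono) auto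
    also have "\<dots> = gap k * (\<Sum>m=1..k. ln (real (card (W m)))) + (\<rho> k)\<^sup>2 / (2 * real n * gap k)"
      using gap_pos[OF k] by (simp add: distrib_left power2_eq_square)
    finally show "(\<integral>s. ref_noise k s + gap k * (?c k + mgf_mean k s - 1) \<partial>sample)
      \<le> gap k * (\<Sum>m=1..k. ln (real (card (W m)))) + (\<rho> k)\<^sup>2 / (2 * real n * gap k)" .
  qed
  have "integrable sample (\<lambda>s. prefix_prob d w s * (\<Sum>k=1..d. \<integral>x. centered_loss k w x \<partial>M))"
    if "w \<in> prefixes d" for w
  proof -
    have w: "w \<in> Pi {1..d} W" using that by auto
    have "integrable sample (prefix_prob d w)"
      using prefix_prob_measurable[OF order_refl w] prefix_prob_abs_le_1[OF order_refl w]
      by (intro integrable_PiM_bounded) (auto intro: prob_space_axioms)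
    then show ?thesis by simp
  qed
  then have "(\<integral>s. (\<Sum>w\<in>prefixes d. prefix_prob d w s * (\<Sum>k=1..d. \<integral>x. centered_loss k w x \<partial>M)) \<partial>sample)
      \<le> (\<integral>s. (\<Sum>k=1..d. ref_noise k s + gap k * (?c k + mgf_mean k s - 1)) \<partial>sample)"
    using int_k sum_prefix_prob_risk_le
    by (intro integral_mono Bochner_Integration.integrable_sum) auto
  also have "\<dots> = (\<Sum>k=1..d. \<integral>s. ref_noise k s + gap k * (?c k + mgf_mean k s - 1) \<partial>sample)"
    using int_k by (intro Bochner_Integration.integral_sum)
  also have "\<dots> \<le> (\<Sum>k=1..d. gap k * (\<Sum>m=1..k. ln (real (card (W m)))) + (\<rho> k)\<^sup>2 / (2 * real n * gap k))"
    by (intro sum_mono le_k)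
  finally show ?thesis .
qed

end


section \<open>Integration against the joint law\<close>

lemma (in prob_space) integral_density_count_space:
  fixes p :: "'b \<Rightarrow> 'a \<Rightarrow> real" and r :: "'b \<Rightarrow> real"
  assumes A: "finite A"
    and p: "\<And>w. w \<in> A \<Longrightarrow> p w \<in> borel_measurable M" "\<And>w s. w \<in> A \<Longrightarrow> p w s \<in> {0..1}"
  shows "(\<integral>(s, w). r w \<partial>density (M \<Otimes>\<^sub>M count_space A) (\<lambda>(s, w). ennreal (p w s)))
    = (\<integral>s. (\<Sum>w\<in>A. p w s * r w) \<partial>M)"
proof -
  interpret C: finite_measure "count_space A" using A by (rule finite_measure_count_space)
  interpret P: pair_sigma_finite M "count_space A" ..
  interpret Q: finite_measure "M \<Otimes>\<^sub>M count_space A"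
    by (intro finite_measure_pair_measure) unfold_locales
  \<comment> \<open>With a finite discrete second factor, joint measurability follows from that of
    each section.\<close>
  have meas: "(\<lambda>(s, w). h w s) \<in> borel_measurable (M \<Otimes>\<^sub>M count_space A)"
    if "\<And>w. w \<in> A \<Longrightarrow> h w \<in> borel_measurable M" for h :: "'b \<Rightarrow> 'a \<Rightarrow> real"
    using measurable_compose_countable'[where f = "\<lambda>w x. h w (fst x)" and g = snd and I = A
        and M = "M \<Otimes>\<^sub>M count_space A"] that A
    by (simp add: case_prod_unfold countable_finite)
  define B where "B = (\<Sum>w\<in>A. \<bar>r w\<bar>)"
  have "\<bar>p w s * r w\<bar> \<le> B" if "w \<in> A" for s w
  proof -
    have "\<bar>p w s\<bar> * \<bar>r w\<bar> \<le> 1 * \<bar>r w\<bar>" using p(2)[OF that] by (intro mult_right_mono) auto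
    also have "\<dots> \<le> B"
      unfolding B_def using A that member_le_sum[of w A "\<lambda>w. \<bar>r w\<bar>"] by simp
    finally show ?thesis by (simp add: abs_mult)
  qed
  then have int: "integrable (M \<Otimes>\<^sub>M count_space A) (\<lambda>(s, w). p w s * r w)"
    using p by (intro Q.integrable_const_bound[where B = B] meas) (auto simp: space_pair_measure)
  \<comment> \<open>The density is rewritten as \<open>ennreal\<close> of a real function of the
    pair, the shape in which \<open>integral_density\<close> applies.\<close>
  have "(\<integral>(s, w). r w \<partial>density (M \<Otimes>\<^sub>M count_space A) (\<lambda>(s, w). ennreal (p w s)))
      = (\<integral>(s, w). r w \<partial>density (M \<Otimes>\<^sub>M count_space A) (\<lambda>x. ennreal ((\<lambda>(s, w). p w s) x)))"
    by (simp add: case_prod_unfold)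
  also have "\<dots> = (\<integral>x. (\<lambda>(s, w). p w s) x *\<^sub>R (\<lambda>(s, w). r w) x \<partial>(M \<Otimes>\<^sub>M count_space A))"
    using p by (intro integral_density meas) (auto simp: space_pair_measure)
  also have "\<dots> = (\<integral>s. (\<integral>w. p w s * r w \<partial>count_space A) \<partial>M)"
    using P.integral_fst'[OF int] by (simp add: case_prod_unfold)
  finally show ?thesis using A by (simp add: lebesgue_integral_count_space_finite)
qed


section \<open>The hierarchical model\<close>

lemma scale_pos: "1 < \<beta> \<Longrightarrow> 0 < scale d \<beta> k"
  by (simp add: scale_def)

lemma scale_mono: "1 < \<beta> \<Longrightarrow> j \<le> k \<Longrightarrow> scale d \<beta> j \<le> scale d \<beta> k"
  unfolding scale_def by (intro power_int_increasing) auto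

lemma scale_le_1: "1 < \<beta> \<Longrightarrow> k \<le> d \<Longrightarrow> scale d \<beta> k \<le> 1"
  using scale_mono[of \<beta> k d d] by (simp add: scale_def)

lemma radius_scale_0: "1 < \<beta> \<Longrightarrow> radius d \<epsilon> \<beta> * scale d \<beta> 0 = \<epsilon>"
  by (simp add: radius_def scale_def power_int_minus)

lemma radius_pos: "0 < \<epsilon> \<Longrightarrow> 1 < \<beta> \<Longrightarrow> 0 < radius d \<epsilon> \<beta>"
  by (simp add: radius_def)

text \<open>The outer radius of shell \<open>j\<close> is at most the inner radius of shell
  \<open>k\<close>. The case \<open>j = 0\<close> is harmless: truncated subtraction makes that
  shell empty.\<close>

lemma level_space_disjoint:
  assumes "0 < \<epsilon>" "1 < \<beta>" "j < k" "x \<in> level_space d \<epsilon> \<beta> k"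
  shows "x \<notin> level_space d \<epsilon> \<beta> j"
proof -
  have "radius d \<epsilon> \<beta> * scale d \<beta> j \<le> radius d \<epsilon> \<beta> * scale d \<beta> (k - 1)"
    using assms radius_pos[of \<epsilon> \<beta> d] by (intro mult_left_mono scale_mono) auto
  then show ?thesis using assms(4) by (auto simp: level_space_def)
qed

lemma level_space_subset:
  assumes "0 < \<epsilon>" "1 < \<beta>" "k \<le> d"
  shows "level_space d \<epsilon> \<beta> k \<subseteq> input_space d \<epsilon> \<beta>"
proof -
  have "radius d \<epsilon> \<beta> * scale d \<beta> 0 \<le> radius d \<epsilon> \<beta> * scale d \<beta> (k - 1)"
    using assms radius_pos[of \<epsilon> \<beta> d] by (intro mult_left_mono scale_mono) auto
  moreover have "radius d \<epsilon> \<beta> * scale d \<beta> k \<le> radius d \<epsilon> \<beta> * 1"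
    using assms radius_pos[of \<epsilon> \<beta> d] by (intro mult_left_mono scale_le_1) auto
  ultimately show ?thesis
    using assms(2) by (auto simp: level_space_def input_space_def radius_scale_0)
qed

section \<open>Measurability of the losses\<close>

lemma hierarchical_output_cong:
  "(\<And>m. m \<in> {1..k} \<Longrightarrow> w m = w' m) \<Longrightarrow>
    hierarchical_output d \<beta> f F k w = hierarchical_output d \<beta> f F k w'"
  by (induction k) (auto simp: fun_eq_iff)

text \<open>The target enters only through level 0, at a single point; this permits replacing it by
  a Borel function.\<close>

lemma hierarchical_output_cong_target:
  "f (scale d \<beta> 0 * x) = g (scale d \<beta> 0 * x) \<Longrightarrow>
    hierarchical_output d \<beta> f F k w x = hierarchical_output d \<beta> g F k w x"
  by (induction k) (auto simp: dilation_def)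

lemma hierarchical_output_measurable:
  assumes f: "f \<in> borel_measurable borel"
    and F: "\<And>m. m \<in> {1..k} \<Longrightarrow> (\<lambda>x. F m x (w m)) \<in> borel_measurable borel"
  shows "hierarchical_output d \<beta> f F k w \<in> borel_measurable borel"
  using F
proof (induction k)
  case 0
  have "(\<lambda>x. f (scale d \<beta> 0 * x)) \<in> borel_measurable borel"
    by (rule measurable_compose[OF _ f]) measurable
  then show ?case by (simp add: dilation_def [abs_def])
next
  case (Suc k)
  then have h: "hierarchical_output d \<beta> f F k w \<in> borel_measurable borel" by simp
  have "(\<lambda>x. F (Suc k) x (w (Suc k))) \<in> borel_measurable borel" using Suc.prems by simp
  from measurable_compose[OF h this] h show ?case by simp
qed

text \<open>Outside (-R, R) the total function \<open>f\<close> is arbitrary, so it is cut off to a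
  Borel function \<open>g\<close>. On the shell the error reads \<open>f\<close> only at
  \<open>x\<close> and at \<open>scale d \<beta> 0 * (x / scale d \<beta> k)\<close>, which is no
  larger in absolute value. The index \<open>j\<close> is separate from \<open>k\<close> to cover
  the losses (\<open>j = k\<close>) and \<open>base\<close> (\<open>j = k - 1\<close>).\<close>

lemma scaled_output_error_measurable:
  assumes eps: "0 < \<epsilon>" and beta: "1 < \<beta>" and k: "k \<le> d"
    and f: "continuous_on {- radius d \<epsilon> \<beta><..<radius d \<epsilon> \<beta>} f"
    and F: "\<And>m. m \<in> {1..j} \<Longrightarrow> (\<lambda>x. F m x (w m)) \<in> borel_measurable borel"
  shows "(\<lambda>x. if x \<in> level_space d \<epsilon> \<beta> k
      then \<bar>scale d \<beta> k * hierarchical_output d \<beta> f F j w (x / scale d \<beta> k) - f x\<bar> else 0)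
    \<in> borel_measurable borel" (is "?L f \<in> _")
proof -
  let ?I = "{- radius d \<epsilon> \<beta><..<radius d \<epsilon> \<beta>}"
  define g where "g x = indicator ?I x *\<^sub>R f x" for x
  have g: "g \<in> borel_measurable borel"
    unfolding g_def by (rule borel_measurable_continuous_on_indicator[OF _ f]) simp
  have f_eq_g: "f y = g y" if "\<bar>y\<bar> < radius d \<epsilon> \<beta>" for y
    using that by (auto simp: g_def indicator_def)
  note [measurable] = g
  have [measurable]: "hierarchical_output d \<beta> g F j w \<in> borel_measurable borel"
    by (intro hierarchical_output_measurable g F)
  have "level_space d \<epsilon> \<beta> k \<in> sets borel"
    unfolding level_space_def by measurable
  then have "?L g \<in> borel_measurable borel"
    by measurable
  moreover have "?L f = ?L g"
  proof
    fix x
    show "?L f x = ?L g x"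
    proof (cases "x \<in> level_space d \<epsilon> \<beta> k")
      case True
      have x: "\<bar>x\<bar> < radius d \<epsilon> \<beta>"
        using True level_space_subset[OF eps beta k] by (auto simp: input_space_def)
      have "\<bar>scale d \<beta> 0 * (x / scale d \<beta> k)\<bar> = scale d \<beta> 0 / scale d \<beta> k * \<bar>x\<bar>"
        using scale_pos[OF beta, of d 0] scale_pos[OF beta, of d k] by (simp add: abs_mult)
      also have "\<dots> \<le> 1 * \<bar>x\<bar>"
        using scale_mono[OF beta, of 0 k d] scale_pos[OF beta, of d k]
        by (intro mult_right_mono) (auto simp: divide_le_eq)
      finally have "\<bar>scale d \<beta> 0 * (x / scale d \<beta> k)\<bar> < radius d \<epsilon> \<beta>" using x by simp
      then have "hierarchical_output d \<beta> f F j w (x / scale d \<beta> k)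
          = hierarchical_output d \<beta> g F j w (x / scale d \<beta> k)"
        by (intro hierarchical_output_cong_target f_eq_g)
      then show ?thesis using f_eq_g[OF x] by simp
    qed simp
  qed
  ultimately show ?thesis by simp
qed

section \<open>The bound for the training mechanism\<close>

theorem theorem3:
  fixes d n :: nat
    and \<epsilon> \<beta> M1 M2 :: real
    and f :: "real \<Rightarrow> real"
    and F :: "nat \<Rightarrow> real \<Rightarrow> 'w \<Rightarrow> real"
    and W :: "nat \<Rightarrow> 'w set"
    and w_true :: "nat \<Rightarrow> 'w"
    and \<rho> lam :: "nat \<Rightarrow> real"
    and \<mu> :: "real measure"
  assumes d: "d \<ge> 1" and n: "n \<ge> 1"
    and eps: "\<epsilon> > 0" and beta: "\<beta> > 1"
    and f0: "f 0 = 0"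
    and diffeo: "diffeomorphism_bounds_on M1 M2 {- radius d \<epsilon> \<beta><..<radius d \<epsilon> \<beta>} f"
    and finite_W: "\<And>k. k \<in> {1..d} \<Longrightarrow> finite (W k)"
    and F_measurable: "\<And>k v. k \<in> {1..d} \<Longrightarrow> v \<in> W k \<Longrightarrow> (\<lambda>x. F k x v) \<in> borel_measurable borel"
    and F_bounded: "\<And>k v x. k \<in> {1..d} \<Longrightarrow> v \<in> W k \<Longrightarrow> \<bar>F k x v\<bar> \<le> \<rho> k"
    and true_in_W: "\<And>k. k \<in> {1..d} \<Longrightarrow> w_true k \<in> W k"
    and realizable: "\<And>k x. k \<in> {1..d} \<Longrightarrow> x \<in> level_correction_dom d \<epsilon> \<beta> f k \<Longrightarrow>
                       level_correction d \<epsilon> \<beta> f k x = F k x (w_true k)"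
    and lam_decreasing: "\<And>k. k \<in> {1..d} \<Longrightarrow> lam k > lam (k + 1)"
    and lam_last: "lam (d + 1) = 0"
    and mu_sets: "sets \<mu> = sets (restrict_space borel (input_space d \<epsilon> \<beta>))"
    and mu_prob: "prob_space \<mu>"
  shows "(\<integral>(s, w). chained_risk d \<epsilon> \<beta> f F n w_true \<mu> w \<partial>training_measure d \<epsilon> \<beta> f F n W lam \<mu>)
      \<le> (\<Sum>k=1..d. 2 * (lam k - lam (k + 1)) * (\<Sum>m=1..k. ln (real (card (W m))))
                    + (\<rho> k)\<^sup>2 / (2 * real n * (lam k - lam (k + 1))))"
proof -
  \<comment> \<open>Error on level \<open>k\<close> before the level-\<open>k\<close> correction:
    the output of \<open>k - 1\<close> levels, measured at scale \<open>k\<close>.\<close>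
  define base where "base k w x = (if x \<in> level_space d \<epsilon> \<beta> k
    then \<bar>scale d \<beta> k * hierarchical_output d \<beta> f F (k - 1) w (x / scale d \<beta> k) - f x\<bar> else 0)"
    for k :: nat and w x
  interpret mu: prob_space \<mu> by (rule mu_prob)
  have cont: "continuous_on {- radius d \<epsilon> \<beta><..<radius d \<epsilon> \<beta>} f"
    using diffeo unfolding diffeomorphism_bounds_on_def smooth_bounds_on_def
    by (auto intro: lipschitz_on_continuous_on)
  have borel_mu: "g \<in> borel_measurable \<mu>" if "g \<in> borel_measurable borel" for g :: "real \<Rightarrow> real"
    using measurable_restrict_space1[OF that] measurable_cong_sets[OF mu_sets refl] by blast
  interpret G: gibbs_chain \<mu> d n W w_true lam \<rho> "level_space d \<epsilon> \<beta>" "level_loss d \<epsilon> \<beta> f F" base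
  proof
    show "0 < n" using n by simp
    fix k assume k: "k \<in> {1..d}"
    show "level_space d \<epsilon> \<beta> k \<in> sets \<mu>"
    proof -
      have "level_space d \<epsilon> \<beta> k \<in> sets borel" unfolding level_space_def by measurable
      then show ?thesis
        using level_space_subset[OF eps beta, of k d] k
        by (auto simp: mu_sets sets_restrict_space intro!: image_eqI[of _ _ "level_space d \<epsilon> \<beta> k"])
    qed
    fix w :: "nat \<Rightarrow> 'w"
    {
      assume w: "w \<in> Pi {1..k} W"
      have F: "(\<lambda>x. F m x (w m)) \<in> borel_measurable borel" if "m \<in> {1..k}" for m
        using that w k by (intro F_measurable) auto
      show "level_loss d \<epsilon> \<beta> f F k w \<in> borel_measurable \<mu>"
        unfolding level_loss_def[abs_def] using k
        by (intro borel_mu scaled_output_error_measurable eps beta cont F) auto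
      show "base k w \<in> borel_measurable \<mu>"
        unfolding base_def[abs_def] using k
        by (intro borel_mu scaled_output_error_measurable eps beta cont F) auto
    }
    fix x
    assume w: "w k \<in> W k"
    show "\<bar>level_loss d \<epsilon> \<beta> f F k w x - base k w x\<bar> \<le> \<rho> k"
    proof (cases "x \<in> level_space d \<epsilon> \<beta> k")
      case True
      obtain j where j: "k = Suc j" using k by (cases k) auto
      define h where "h = hierarchical_output d \<beta> f F j w (x / scale d \<beta> k)"
      have "\<bar>level_loss d \<epsilon> \<beta> f F k w x - base k w x\<bar>
          = \<bar>\<bar>scale d \<beta> k * (h + F k h (w k)) - f x\<bar> - \<bar>scale d \<beta> k * h - f x\<bar>\<bar>"
        using True by (simp add: level_loss_def base_def j h_def)
      \<comment> \<open>Reverse triangle inequality: only the scaled correction survives, and the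
        scale is at most 1.\<close>
      also have "\<dots> \<le> \<bar>scale d \<beta> k * F k h (w k)\<bar>"
        by (rule order_trans[OF abs_triangle_ineq3]) (simp add: algebra_simps)
      also have "\<dots> \<le> 1 * \<rho> k"
        unfolding abs_mult using scale_pos[OF beta, of d k] scale_le_1[OF beta, of k d] k F_bounded[OF k w]
        by (intro mult_mono) auto
      finally show ?thesis by simp
    next
      case False
      \<comment> \<open>Both errors are 0 here; the bound at the arbitrary point 0 supplies
        \<open>\<rho> k \<ge> 0\<close>.\<close>
      then show ?thesis using F_bounded[OF k w, of 0] by (simp add: level_loss_def base_def)
    qed
  next
    fix k and w w' :: "nat \<Rightarrow> 'w"
    show "level_loss d \<epsilon> \<beta> f F k w = level_loss d \<epsilon> \<beta> f F k w'"
      if "\<And>m. m \<in> {1..k} \<Longrightarrow> w m = w' m"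
      using hierarchical_output_cong[OF that] by (simp add: level_loss_def fun_eq_iff)
    show "base k w = base k w'" if "\<And>m. m \<in> {1..<k} \<Longrightarrow> w m = w' m"
    proof -
      have "hierarchical_output d \<beta> f F (k - 1) w = hierarchical_output d \<beta> f F (k - 1) w'"
        using that by (intro hierarchical_output_cong) auto
      then show ?thesis by (simp add: base_def fun_eq_iff)
    qed
  qed (use finite_W true_in_W lam_decreasing lam_last level_space_disjoint[OF eps beta] in
      \<open>auto simp: level_loss_def base_def\<close>)
  have emp: "G.emp (level_loss d \<epsilon> \<beta> f F k w) s = empirical_loss d \<epsilon> \<beta> f F n k w s" for k w s
    by (simp add: G.emp_def empirical_loss_def)
  have gibbs: "G.gibbs = gibbs_conditional d \<epsilon> \<beta> f F n W lam"
    by (simp add: G.gibbs_def gibbs_conditional_def emp fun_eq_iff)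
  have risk: "chained_risk d \<epsilon> \<beta> f F n w_true \<mu> w = (\<Sum>k=1..d. \<integral>x. G.centered_loss k w x \<partial>\<mu>)"
    if "w \<in> G.prefixes d" for w
    using G.integral_emp_loss_diff[of w] that
    by (auto simp: chained_risk_def sample_measure_def emp)
  interpret S: prob_space G.sample by (intro prob_space_PiM mu_prob)
  have "(\<integral>(s, w). chained_risk d \<epsilon> \<beta> f F n w_true \<mu> w \<partial>training_measure d \<epsilon> \<beta> f F n W lam \<mu>)
      = (\<integral>(s, w). chained_risk d \<epsilon> \<beta> f F n w_true \<mu> w
          \<partial>density (G.sample \<Otimes>\<^sub>M count_space (G.prefixes d)) (\<lambda>(s, w). ennreal (G.prefix_prob d w s)))"
    by (simp add: training_measure_def sample_measure_def G.prefix_prob_def gibbs)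
  also have "\<dots> = (\<integral>s. (\<Sum>w\<in>G.prefixes d. G.prefix_prob d w s * chained_risk d \<epsilon> \<beta> f F n w_true \<mu> w) \<partial>G.sample)"
  proof (intro S.integral_density_count_space G.finite_prefixes order_refl)
    fix w s assume "w \<in> G.prefixes d"
    then have w: "w \<in> Pi {1..d} W" by auto
    show "G.prefix_prob d w \<in> borel_measurable G.sample"
      by (rule G.prefix_prob_measurable[OF order_refl w])
    show "G.prefix_prob d w s \<in> {0..1}"
      using G.prefix_prob_le_1[OF order_refl w, of s] G.prefix_prob_pos[OF order_refl, of w s] by simp
  qed
  also have "\<dots> = (\<integral>s. (\<Sum>w\<in>G.prefixes d. G.prefix_prob d w s * (\<Sum>k=1..d. \<integral>x. G.centered_loss k w x \<partial>\<mu>)) \<partial>G.sample)"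
    by (simp add: risk cong: sum.cong)
  also have "\<dots> \<le> (\<Sum>k=1..d. G.gap k * (\<Sum>m=1..k. ln (real (card (W m)))) + (\<rho> k)\<^sup>2 / (2 * real n * G.gap k))"
    by (rule G.expected_risk_le)
  also have "\<dots> \<le> (\<Sum>k=1..d. 2 * (lam k - lam (k + 1)) * (\<Sum>m=1..k. ln (real (card (W m))))
                    + (\<rho> k)\<^sup>2 / (2 * real n * (lam k - lam (k + 1))))"
  proof (intro sum_mono)
    fix k assume k: "k \<in> {1..d}"
    \<comment> \<open>Each \<open>W m\<close> contains \<open>w_true m\<close>, so the logarithms
      are nonnegative and the factor 1 may be relaxed to 2.\<close>
    have "0 \<le> (\<Sum>m=1..k. ln (real (card (W m))))"
    proof (intro sum_nonneg ln_ge_zero)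
      fix m assume "m \<in> {1..k}"
      then have "0 < card (W m)" using k finite_W[of m] true_in_W[of m] by (auto simp: card_gt_0_iff)
      then show "1 \<le> real (card (W m))" by simp
    qed
    then have "0 \<le> G.gap k * (\<Sum>m=1..k. ln (real (card (W m))))"
      using G.gap_pos[OF k] by simp
    then have "G.gap k * (\<Sum>m=1..k. ln (real (card (W m))))
        \<le> 2 * G.gap k * (\<Sum>m=1..k. ln (real (card (W m))))"
      by (simp only: mult.assoc)
    then show "G.gap k * (\<Sum>m=1..k. ln (real (card (W m)))) + (\<rho> k)\<^sup>2 / (2 * real n * G.gap k)
      \<le> 2 * (lam k - lam (k + 1)) * (\<Sum>m=1..k. ln (real (card (W m))))
        + (\<rho> k)\<^sup>2 / (2 * real n * (lam k - lam (k + 1)))"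
      unfolding G.gap_def by (rule add_right_mono)
  qed
  finally show ?thesis .
qed

end
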